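(* Let $C$ be a commutative unital ring and $G$ a nontrivial group. Then there are no minimal $C$-linear traces $t: CG \to C$.
   Context: $CG$ is the group ring of $G$ over $C$. A $C$-linear trace $t:CG\to C$ is a map satisfying $t(x+y)=t(x)+t(y)$, $t(xy)=t(yx)$, and $t(cx)=ct(x)$ for all $x,y\in CG$ and $c\in C$; it is minimal if for all $x\in CG$, $t(x)=0$ implies $x\in[CG,CG]$, where $[CG,CG]$ is the additive subgroup of $CG$ generated by all commutators $xy-yx$ ($x,y\in CG$).
   Formalization: The commutative unital ring C is assumed to satisfy 1 ≠ 0; over the zero ring CG = 0 and the zero map is a minimal trace, so the claim fails there. *)

theory Defs
  imports "HOL-Library.Poly_Mapping" "HOL-Computational_Algebra.Group_Closure"
begin

text \<open>
  The type class of arbitrary, not necessarily commutative groups is \<^class>\<open>group_add\<close>;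
  its operation is written additively. The type of finitely supported functions from a group
  \<open>'g\<close> to a ring \<open>'c\<close> then carries the convolution product, with
  \<open>single g a * single h b = single (g + h) (a * b)\<close>, so that it is the group ring of
  \<open>'g\<close> over \<open>'c\<close>.
\<close>

type_synonym ('g, 'c) group_ring = "'g \<Rightarrow>\<^sub>0 'c"

definition scale :: "'c::comm_ring_1 \<Rightarrow> ('g::group_add, 'c) group_ring \<Rightarrow> ('g, 'c) group_ring"
  where "scale c x = Poly_Mapping.map ((*) c) x"

lemma lookup_scale: "Poly_Mapping.lookup (scale c x) g = c * Poly_Mapping.lookup x g"
  by (simp add: scale_def map.rep_eq when_def)

definition commutator_subgroup :: "'a::ring_1 set"
  where "commutator_subgroup = group_closure {x * y - y * x | x y. True}"

definition linear_trace :: "(('g::group_add, 'c::comm_ring_1) group_ring \<Rightarrow> 'c) \<Rightarrow> bool"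
  where "linear_trace t \<longleftrightarrow>
    (\<forall>x y. t (x + y) = t x + t y) \<and>
    (\<forall>x y. t (x * y) = t (y * x)) \<and>
    (\<forall>c x. t (scale c x) = c * t x)"

definition minimal_trace :: "(('g::group_add, 'c::comm_ring_1) group_ring \<Rightarrow> 'c) \<Rightarrow> bool"
  where "minimal_trace t \<longleftrightarrow>
    linear_trace t \<and> (\<forall>x. t x = 0 \<longrightarrow> x \<in> commutator_subgroup)"

end

theory Submission
  imports Defs "HOL.Modules"
begin

text \<open>
  Let \<open>g\<close> be nontrivial. If \<open>t\<close> is minimal, then \<open>t\<close> kills \<open>t(g) 1 - t(1) g\<close>, which is therefore
  a combination of commutators. The coefficient at the identity is a trace, so it vanishes there,
  and \<open>t(g) = 0\<close>. Hence \<open>g\<close> itself lies in the commutator subgroup, which the augmentation,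
  being a trace with value \<open>1\<close> at \<open>g\<close>, rules out.
\<close>

lemma additive_vanishes_on_commutator_subgroup:
  fixes f :: "'a::ring_1 \<Rightarrow> 'b::ab_group_add"
  assumes f: "additive f" and comm: "\<And>x y. f (x * y) = f (y * x)"
    and x: "x \<in> commutator_subgroup"
  shows "f x = 0"
  using x unfolding commutator_subgroup_def
  by (induction rule: group_closure.induct)
    (auto simp: additive.zero[OF f] additive.diff[OF f] comm)

text \<open>A finitely supported function is built from zero by updates at keys outside its support,
  and each such update adds one \<open>single\<close>.\<close>

lemma poly_mapping_single_induct [case_names single add]:
  fixes x :: "'a \<Rightarrow>\<^sub>0 'b::monoid_add"
  assumes single: "\<And>g a. P (Poly_Mapping.single g a)"
    and add: "\<And>x y. P x \<Longrightarrow> P y \<Longrightarrow> P (x + y)"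
  shows "P x"
proof (induction x rule: update_induct)
  case const
  then show ?case
    using single[of _ 0] by simp
next
  case (update x g a)
  have "Poly_Mapping.update g a x = x + Poly_Mapping.single g a"
    using update.hyps
    by (intro poly_mapping_eqI) (auto simp: lookup_update lookup_add lookup_single in_keys_iff when_def)
  then show ?case
    using update single add by simp
qed

text \<open>Both sides are additive in \<open>x\<close> and in \<open>y\<close>, so inducting on one
  argument and then on the other reduces the trace identity to monomials.\<close>

lemma additive_commutes_if_single:
  fixes f :: "('g::group_add, 'c::comm_ring_1) group_ring \<Rightarrow> 'b::ab_group_add"
  assumes f: "additive f"
    and singles: "\<And>g h a b. f (Poly_Mapping.single g a * Poly_Mapping.single h b) =
      f (Poly_Mapping.single h b * Poly_Mapping.single g a)"
  shows "f (x * y) = f (y * x)"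
proof (induction x rule: poly_mapping_single_induct)
  case (single g a)
  show ?case
    by (induction y rule: poly_mapping_single_induct)
      (simp_all add: singles distrib_left distrib_right additive.add[OF f])
next
  case (add x1 x2)
  then show ?case
    by (simp add: distrib_left distrib_right additive.add[OF f])
qed

definition augmentation :: "('g::group_add, 'c::comm_ring_1) group_ring \<Rightarrow> 'c"
  where "augmentation x = Sum_any (Poly_Mapping.lookup x)"

lemma additive_augmentation: "additive augmentation"
  by unfold_locales (simp add: augmentation_def lookup_add Sum_any.distrib)

lemma augmentation_single [simp]: "augmentation (Poly_Mapping.single g a) = a"
  by (simp add: augmentation_def lookup_single)

text \<open>On monomials the augmentation of a product is the product of the coefficients, which is
  symmetric because the coefficient ring is commutative.\<close>

lemma augmentation_commutator_subgroup:
  "x \<in> commutator_subgroup \<Longrightarrow> augmentation x = 0"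
  by (erule additive_vanishes_on_commutator_subgroup[OF additive_augmentation, rotated])
    (rule additive_commutes_if_single[OF additive_augmentation], simp add: mult_single mult.commute)

text \<open>The coefficient at the identity is a trace even for noncommutative groups: a left
  inverse is a right inverse, so \<open>g + h\<close> and \<open>h + g\<close> vanish
  together.\<close>

lemma lookup_zero_commutator_subgroup:
  fixes x :: "('g::group_add, 'c::comm_ring_1) group_ring"
  assumes "x \<in> commutator_subgroup"
  shows "Poly_Mapping.lookup x 0 = 0"
proof -
  let ?e = "\<lambda>x :: ('g, 'c) group_ring. Poly_Mapping.lookup x 0"
  have e: "additive ?e"
    by unfold_locales (simp add: lookup_add)
  have swap: "g + h = 0 \<longleftrightarrow> h + g = 0" for g h :: 'g
    by (metis add_eq_0_iff eq_neg_iff_add_eq_0)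
  have "?e (u * v) = ?e (v * u)" for u v
    by (rule additive_commutes_if_single[OF e])
      (simp add: mult_single lookup_single swap mult.commute when_def)
  then show ?thesis
    using additive_vanishes_on_commutator_subgroup[OF e _ assms] by blast
qed

theorem corollary15:
  assumes "\<exists>g::'g::group_add. g \<noteq> 0"
  shows "\<not> (\<exists>t :: ('g, 'c::comm_ring_1) group_ring \<Rightarrow> 'c. minimal_trace t)"
proof
  assume "\<exists>t :: ('g, 'c) group_ring \<Rightarrow> 'c. minimal_trace t"
  then obtain t :: "('g, 'c) group_ring \<Rightarrow> 'c" where lin: "linear_trace t"
    and min: "\<And>x. t x = 0 \<Longrightarrow> x \<in> commutator_subgroup"
    unfolding minimal_trace_def by blast
  obtain g :: 'g where g: "g \<noteq> 0"
    using assms by blast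
  let ?g = "Poly_Mapping.single g (1 :: 'c)"
  interpret t: additive t
    using lin by unfold_locales (simp add: linear_trace_def)
  have t_scale: "t (scale c x) = c * t x" for c x
    using lin by (simp add: linear_trace_def)
  define x where "x = scale (t ?g) 1 - scale (t 1) ?g"
  have "t x = 0"
    by (simp add: x_def t.diff t_scale mult.commute)
  then have "Poly_Mapping.lookup x 0 = 0"
    by (intro lookup_zero_commutator_subgroup min)
  \<comment> \<open>As \<open>g\<close> is not the identity, only the first summand of
    \<open>x\<close> contributes to the coefficient at \<open>0\<close>.\<close>
  then have "t ?g = 0"
    using g by (simp add: x_def lookup_minus lookup_scale lookup_single lookup_one)
  then have "augmentation ?g = 0"
    by (intro augmentation_commutator_subgroup min)
  \<comment> \<open>The augmentation of \<open>?g\<close> is \<open>1\<close>, and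
    \<open>comm_ring_1\<close> includes the axiom that \<open>0\<close> and \<open>1\<close>
    differ.\<close>
  then show False
    by simp
qed

end
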